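(* Let $d$ and $n$ be positive integers with $d\mid n$, let $\zeta\in\mathbb{C}$ be a primitive $d$-th root of unity, and let $T$ be a rooted tree on $[n]=\{1,\dots,n\}$, regarded as an endofunction of $[n]$. If $\sigma(d;T)>0$, then $$\sigma(d;T)=g_T(\zeta,\zeta^2,\dots,\zeta^d).$$
   Context: A rooted tree is a directed tree with a distinguished root node $R$ such that all edges point towards the root. It is regarded as the endofunction $T$ of its node set that sends each non-root node to the endpoint of its outgoing edge and sends $R$ to itself. For an endofunction $T$ on a set of size $n$ with $d\mid n$, a subset $W$ of cardinality $n/d$ is $d$-splitting if $W\cup TW\cup\cdots\cup T^{d-1}W$ is the whole set ($T^i$ is the $i$-fold composition); $\sigma(d;T)$ is the number of $d$-splitting subsets. A subset $U$ is $T$-invariant if $TU\subseteq U$. A $d$-flag of $T$-invariant subsets of $[n]$ is a sequence $\emptyset=U_0\subseteq U_1\subseteq\cdots\subseteq U_{d-1}\subseteq U_d=[n]$ with every $U_i$ $T$-invariant. The generating function of $d$-flags is $g_T(t_1,\dots,t_d)=\sum_J a_J\,t_1^{j_1}\cdots t_d^{j_d}$, the sum over $d$-tuples $J=(j_1,\dots,j_d)$ of non-negative integers, where $a_J$ is the number of $d$-flags with $|U_i|=j_1+\cdots+j_i$ for all $1\le i\le d$. *)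

theory Defs
  imports Complex_Main "HOL-Library.FuncSet"
begin

text \<open>A directed graph is given by a vertex set \<open>V\<close> and a set of arcs \<open>A \<subseteq> V \<times> V\<close>, where
  \<open>(u, v) \<in> A\<close> is an arc from \<open>u\<close> to \<open>v\<close>.\<close>

definition undirected_cycle :: "('a \<times> 'a) set \<Rightarrow> 'a list \<Rightarrow> bool" where
  "undirected_cycle A xs \<longleftrightarrow>
     3 \<le> length xs \<and> distinct xs \<and>
     (\<forall>i<length xs. (xs ! i, xs ! (Suc i mod length xs)) \<in> A \<union> A\<inverse>)"

text \<open>An orientation of an undirected tree: the last two clauses exclude, in this order,
  loops together with pairs of opposite arcs, and cycles of the underlying undirected graph.\<close>

definition directed_tree :: "'a set \<Rightarrow> ('a \<times> 'a) set \<Rightarrow> bool" where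
  "directed_tree V A \<longleftrightarrow>
     finite V \<and> V \<noteq> {} \<and> A \<subseteq> V \<times> V \<and>
     (\<forall>u\<in>V. \<forall>v\<in>V. (u, v) \<in> (A \<union> A\<inverse>)\<^sup>*) \<and>
     (\<forall>u v. (u, v) \<in> A \<longrightarrow> (v, u) \<notin> A) \<and>
     (\<nexists>xs. undirected_cycle A xs)"

text \<open>All edges point towards the root: the path from any vertex to \<open>R\<close> is a directed path.\<close>

definition rooted_tree :: "'a set \<Rightarrow> ('a \<times> 'a) set \<Rightarrow> 'a \<Rightarrow> bool" where
  "rooted_tree V A R \<longleftrightarrow> directed_tree V A \<and> R \<in> V \<and> (\<forall>v\<in>V. (v, R) \<in> A\<^sup>*)"

text \<open>Values of \<open>T\<close> outside \<open>V\<close> are irrelevant and left unconstrained. In a rooted tree every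
  non-root vertex has exactly one outgoing arc, so \<open>T\<close> is determined on \<open>V\<close>.\<close>

definition rooted_tree_endofunction ::
    "'a set \<Rightarrow> ('a \<times> 'a) set \<Rightarrow> 'a \<Rightarrow> ('a \<Rightarrow> 'a) \<Rightarrow> bool" where
  "rooted_tree_endofunction V A R T \<longleftrightarrow>
     rooted_tree V A R \<and> T R = R \<and> (\<forall>v\<in>V - {R}. (v, T v) \<in> A)"

definition splitting_subset :: "nat \<Rightarrow> 'a set \<Rightarrow> ('a \<Rightarrow> 'a) \<Rightarrow> 'a set \<Rightarrow> bool" where
  "splitting_subset d V T W \<longleftrightarrow>
     W \<subseteq> V \<and> card W = card V div d \<and> (\<Union>i<d. (T ^^ i) ` W) = V"

definition num_splitting_subsets :: "nat \<Rightarrow> 'a set \<Rightarrow> ('a \<Rightarrow> 'a) \<Rightarrow> nat" where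
  "num_splitting_subsets d V T = card {W. splitting_subset d V T W}"

definition invariant_subset :: "('a \<Rightarrow> 'a) \<Rightarrow> 'a set \<Rightarrow> bool" where
  "invariant_subset T U \<longleftrightarrow> T ` U \<subseteq> U"

text \<open>The sequence \<open>U\<^sub>0, \<dots>, U\<^sub>d\<close> is a function that is extensional on \<open>{0..d}\<close>, so that distinct
  functions are distinct sequences; the same is done below for the exponent tuples
  \<open>J = (j\<^sub>1, \<dots>, j\<^sub>d)\<close>.\<close>

definition invariant_flags :: "nat \<Rightarrow> 'a set \<Rightarrow> ('a \<Rightarrow> 'a) \<Rightarrow> (nat \<Rightarrow> 'a set) set" where
  "invariant_flags d V T =
     {U \<in> {0..d} \<rightarrow>\<^sub>E Pow V.
        U 0 = {} \<and> U d = V \<and> (\<forall>i<d. U i \<subseteq> U (Suc i)) \<and> (\<forall>i\<le>d. invariant_subset T (U i))}"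

definition flag_count :: "nat \<Rightarrow> 'a set \<Rightarrow> ('a \<Rightarrow> 'a) \<Rightarrow> (nat \<Rightarrow> nat) \<Rightarrow> nat" where
  "flag_count d V T J =
     card {U \<in> invariant_flags d V T. \<forall>i\<in>{1..d}. card (U i) = (\<Sum>k=1..i. J k)}"

text \<open>The sum over all tuples \<open>J\<close> is written over those with nonzero coefficient, because a sum
  over an infinite index set is zero by convention. The lemma below shows that the
  remaining index set is finite.\<close>

definition flag_gf ::
    "nat \<Rightarrow> 'a set \<Rightarrow> ('a \<Rightarrow> 'a) \<Rightarrow> (nat \<Rightarrow> 'b::comm_semiring_1) \<Rightarrow> 'b" where
  "flag_gf d V T t =
     (\<Sum>J | J \<in> {1..d} \<rightarrow>\<^sub>E UNIV \<and> flag_count d V T J \<noteq> 0.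
        of_nat (flag_count d V T J) * (\<Prod>i=1..d. t i ^ J i))"

lemma finite_flag_gf_support:
  assumes "finite V"
  shows "finite {J \<in> {1..d} \<rightarrow>\<^sub>E UNIV. flag_count d V T J \<noteq> 0}"
proof (rule finite_subset)
  show "finite ({1..d} \<rightarrow>\<^sub>E {..card V})"
    by (intro finite_PiE) auto
  show "{J \<in> {1..d} \<rightarrow>\<^sub>E UNIV. flag_count d V T J \<noteq> 0} \<subseteq> {1..d} \<rightarrow>\<^sub>E {..card V}"
  proof
    fix J assume J: "J \<in> {J \<in> {1..d} \<rightarrow>\<^sub>E UNIV. flag_count d V T J \<noteq> 0}"
    then have "card {U \<in> invariant_flags d V T. \<forall>i\<in>{1..d}. card (U i) = (\<Sum>k=1..i. J k)} \<noteq> 0"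
      by (simp add: flag_count_def)
    then have "{U \<in> invariant_flags d V T. \<forall>i\<in>{1..d}. card (U i) = (\<Sum>k=1..i. J k)} \<noteq> {}"
      by (intro notI) (simp only: card.empty)
    then obtain U where F: "U \<in> invariant_flags d V T"
      and c: "\<forall>i\<in>{1..d}. card (U i) = (\<Sum>k=1..i. J k)"
      by blast
    from F have U: "U \<in> {0..d} \<rightarrow>\<^sub>E Pow V"
      by (simp add: invariant_flags_def)
    have "J i \<le> card V" if i: "i \<in> {1..d}" for i
    proof -
      have "J i \<le> (\<Sum>k=1..i. J k)"
        using i by (intro member_le_sum) auto
      also have "\<dots> = card (U i)" using c i by (metis (no_types))
      also have "\<dots> \<le> card V"
        using PiE_mem[OF U, of i] i assms by (intro card_mono) auto
      finally show ?thesis .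
    qed
    then show "J \<in> {1..d} \<rightarrow>\<^sub>E {..card V}"
      using J by (auto simp: PiE_iff)
  qed
qed

definition primitive_root_of_unity :: "nat \<Rightarrow> 'a::monoid_mult \<Rightarrow> bool" where
  "primitive_root_of_unity d z \<longleftrightarrow> z ^ d = 1 \<and> (\<forall>k. 0 < k \<and> k < d \<longrightarrow> z ^ k \<noteq> 1)"

end

theory Submission
  imports Defs
begin

text \<open>A splitting subset \<open>W\<close> partitions the tree into directed paths \<open>w, T w, \<dots>, T\<^sup>d\<^sup>-\<^sup>1 w\<close> with
  \<open>d\<close> vertices. Such a partition is unique, as it is forced from the leaves upwards, so it has to be
  shown that the generating function takes the value 1. Flags are labellings
  \<open>f : V \<rightarrow> {1, \<dots>, d}\<close> with \<open>f (T v) \<le> f v\<close>, weighted by \<open>\<Prod>\<^sub>v \<zeta>\<^bsup>f v\<^esup>\<close>. Removing a path nothing else is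
  attached below, whose top hangs from a vertex with label \<open>j\<close>, divides the weighted sum by
  \<open>h\<^sub>d(\<zeta>\<^sup>j, \<dots>, \<zeta>\<^sup>d)\<close>, where \<open>h\<^sub>d\<close> is the complete homogeneous symmetric polynomial, and this equals 1
  for every \<open>j\<close>. Hence the sum does not change, and it is 1 for the empty set.\<close>

section \<open>Complete homogeneous symmetric polynomials at roots of unity\<close>

text \<open>\<open>hom_sum d z r j\<close> is \<open>h\<^sub>r(z\<^sup>j, z\<^sup>j\<^sup>+\<^sup>1, \<dots>, z\<^sup>d)\<close>.\<close>

primrec hom_sum :: "nat \<Rightarrow> 'a::comm_semiring_1 \<Rightarrow> nat \<Rightarrow> nat \<Rightarrow> 'a" where
  "hom_sum d z 0 j = 1"
| "hom_sum d z (Suc r) j = (\<Sum>i=j..d. z ^ i * hom_sum d z r i)"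

lemma hom_sum_Suc_step:
  "j \<le> d \<Longrightarrow> hom_sum d z (Suc r) j = z ^ j * hom_sum d z r j + hom_sum d z (Suc r) (Suc j)"
  by (simp add: sum.atLeast_Suc_atMost)

text \<open>The Gaussian binomial formula with denominators cleared, since some 1 - z^i may vanish.
  Both sides obey the recursion of \<open>hom_sum_Suc_step\<close>: induct on \<open>r\<close> and,
  inside, downwards on \<open>j\<close> from \<open>Suc d\<close>, where the sum is empty.\<close>

lemma hom_sum_closed_form:
  fixes z :: "'a::comm_ring_1"
  assumes "z ^ d = 1" "j \<le> Suc d"
  shows "hom_sum d z r j * (\<Prod>i=1..r. 1 - z ^ i) = (\<Prod>i=1..r. z ^ j - z ^ i)"
  using assms(2)
proof (induction r arbitrary: j)
  case 0
  then show ?case by simp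
next
  case (Suc r)
  from Suc.prems show ?case
  proof (induction j rule: inc_induct)
    case base
    have "(\<Prod>i=1..Suc r. z ^ Suc d - z ^ i) = 0"
      using assms(1) by (intro prod_zero) (auto intro!: bexI[of _ 1])
    then show ?case by simp
  next
    case (step j)
    let ?P = "\<Prod>i=1..r. z ^ j - z ^ i"
    let ?D = "\<Prod>i=1..r. 1 - z ^ i"
    \<comment> \<open>An index shift turns the factors for \<open>Suc j\<close> into z * (z^j - z^i)
      with i from 0 to r; the factor at i = 0 yields z^j - 1.\<close>
    have "(\<Prod>i=1..Suc r. z ^ Suc j - z ^ i) = (\<Prod>i=0..r. z ^ Suc j - z ^ Suc i)"
      using prod.shift_bounds_cl_Suc_ivl[of "\<lambda>i. z ^ Suc j - z ^ i" 0 r] by simp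
    also have "\<dots> = (\<Prod>i=0..r. z * (z ^ j - z ^ i))"
      by (simp add: algebra_simps)
    also have "\<dots> = z ^ Suc r * (\<Prod>i=0..r. z ^ j - z ^ i)"
      by (simp add: prod.distrib)
    also have "\<dots> = z ^ Suc r * (z ^ j - 1) * ?P"
      by (simp add: prod.atLeast_Suc_atMost[of 0 r])
    finally have shift: "(\<Prod>i=1..Suc r. z ^ Suc j - z ^ i) = z ^ Suc r * (z ^ j - 1) * ?P" .
    have "hom_sum d z (Suc r) j * (\<Prod>i=1..Suc r. 1 - z ^ i) =
        z ^ j * (hom_sum d z r j * ?D) * (1 - z ^ Suc r)
        + hom_sum d z (Suc r) (Suc j) * (\<Prod>i=1..Suc r. 1 - z ^ i)"
      using step.hyps by (subst hom_sum_Suc_step) (auto simp: algebra_simps simp del: hom_sum.simps)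
    also have "\<dots> = z ^ j * ?P * (1 - z ^ Suc r) + z ^ Suc r * (z ^ j - 1) * ?P"
      using Suc.IH[of j] step by (simp only: shift)
    \<comment> \<open>Here z^j * (1 - z^(r+1)) + z^(r+1) * (z^j - 1) = z^j - z^(r+1), which is the
      last factor.\<close>
    also have "\<dots> = (\<Prod>i=1..Suc r. z ^ j - z ^ i)"
      by (simp add: algebra_simps)
    finally show ?case .
  qed
qed

text \<open>At j = d all powers involved are 1. For 1 <= j < d the values at j and j + 1 differ by
  z^j * h_(d-1)(z^j, ..., z^d). This vanishes: the product in the closed form has a zero factor at i
  = j, while primitivity keeps the denominator nonzero.\<close>

lemma hom_sum_primitive_root:
  fixes z :: "'a::idom"
  assumes "primitive_root_of_unity d z" "1 \<le> j" "j \<le> d"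
  shows "hom_sum d z d j = 1"
  using assms(3,2)
proof (induction j rule: inc_induct)
  case base
  have "hom_sum d z r d = 1" for r
    using assms(1) by (induction r) (auto simp: primitive_root_of_unity_def)
  then show ?case .
next
  case (step j)
  obtain r where r: "d = Suc r" using step.hyps by (cases d) auto
  have z: "z ^ d = 1" "\<And>k. 0 < k \<Longrightarrow> k < d \<Longrightarrow> z ^ k \<noteq> 1"
    using assms(1) by (auto simp: primitive_root_of_unity_def)
  have "(\<Prod>i=1..r. z ^ j - z ^ i) = 0"
    using step r by (intro prod_zero) (auto intro!: bexI[of _ j])
  moreover have "(\<Prod>i=1..r. 1 - z ^ i) \<noteq> 0"
    using z(2) r by (auto simp: eq_commute[of 1])
  moreover have "hom_sum d z r j * (\<Prod>i=1..r. 1 - z ^ i) = (\<Prod>i=1..r. z ^ j - z ^ i)"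
    using step by (intro hom_sum_closed_form[OF z(1)]) simp
  ultimately have "hom_sum d z r j = 0"
    by (metis mult_eq_0_iff)
  then show ?case
    using step hom_sum_Suc_step[of j d z r] r by (simp del: hom_sum.simps)
qed

section \<open>Flags as order-preserving labellings\<close>

text \<open>\<open>S\<close> will run through the vertex sets left while paths are removed. They
  need not be closed under \<open>T\<close>, hence the guard \<open>T v \<in> S\<close>.\<close>

definition labellings :: "nat \<Rightarrow> 'a set \<Rightarrow> ('a \<Rightarrow> 'a) \<Rightarrow> ('a \<Rightarrow> nat) set" where
  "labellings d S T = {f \<in> S \<rightarrow>\<^sub>E {1..d}. \<forall>v\<in>S. T v \<in> S \<longrightarrow> f (T v) \<le> f v}"

lemma finite_labellings: "finite S \<Longrightarrow> finite (labellings d S T)"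
  unfolding labellings_def by (rule finite_subset[of _ "S \<rightarrow>\<^sub>E {1..d}"]) (auto intro: finite_PiE)

definition flag_of :: "nat \<Rightarrow> 'a set \<Rightarrow> ('a \<Rightarrow> nat) \<Rightarrow> nat \<Rightarrow> 'a set" where
  "flag_of d V f = (\<lambda>i\<in>{0..d}. {v \<in> V. f v \<le> i})"

definition label_counts :: "nat \<Rightarrow> 'a set \<Rightarrow> ('a \<Rightarrow> nat) \<Rightarrow> nat \<Rightarrow> nat" where
  "label_counts d V f = (\<lambda>i\<in>{1..d}. card {v \<in> V. f v = i})"

text \<open>The inverse labels v by the index of the first member of the flag that contains v.
  Invariance of all the sets {v. f v <= i} amounts to f (T v) <= f v.\<close>

lemma bij_betw_flag_of:
  assumes "T ` V \<subseteq> V" "d > 0"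
  shows "bij_betw (flag_of d V) (labellings d V T) (invariant_flags d V T)"
proof (rule bij_betw_byWitness[where f' = "\<lambda>U. \<lambda>v\<in>V. LEAST i. v \<in> U i"])
  show "\<forall>f\<in>labellings d V T. (\<lambda>v\<in>V. LEAST i. v \<in> flag_of d V f i) = f"
  proof
    fix f assume f: "f \<in> labellings d V T"
    show "(\<lambda>v\<in>V. LEAST i. v \<in> flag_of d V f i) = f"
    proof
      fix v
      show "(\<lambda>v\<in>V. LEAST i. v \<in> flag_of d V f i) v = f v"
      proof (cases "v \<in> V")
        case True
        have fv: "f v \<in> {1..d}" using f True by (auto simp: labellings_def)
        have "(LEAST i. v \<in> flag_of d V f i) = f v"
        proof (rule Least_equality)
          show "v \<in> flag_of d V f (f v)" using True fv by (simp add: flag_of_def)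
        next
          fix i assume "v \<in> flag_of d V f i"
          then show "f v \<le> i" using fv by (cases "i \<le> d") (auto simp: flag_of_def)
        qed
        then show ?thesis using True by simp
      next
        case False
        then show ?thesis using f by (auto simp: labellings_def PiE_def extensional_def)
      qed
    qed
  qed
next
  \<comment> \<open>An increasing flag is recovered from these first indices; they lie in {1..d}
    because \<open>U 0\<close> is empty and \<open>U d\<close> is \<open>V\<close>.\<close>
  have least: "(\<forall>i\<le>d. v \<in> U i \<longleftrightarrow> (LEAST i. v \<in> U i) \<le> i) \<and> (LEAST i. v \<in> U i) \<in> {1..d}"
    if U: "U \<in> invariant_flags d V T" and v: "v \<in> V" for U v
  proof -
    have d: "v \<in> U d" using U v by (auto simp: invariant_flags_def)
    have mono: "U i \<subseteq> U j" if "i \<le> j" "j \<le> d" for i j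
      using that
    proof (induction j rule: dec_induct)
      case (step k)
      then have "U k \<subseteq> U (Suc k)" using U by (simp add: invariant_flags_def)
      then show ?case using step by auto
    qed simp
    have L: "v \<in> U (LEAST i. v \<in> U i)" using d by (rule LeastI)
    have "(LEAST i. v \<in> U i) \<noteq> 0"
    proof
      assume "(LEAST i. v \<in> U i) = 0"
      with L have "v \<in> U 0" by simp
      then show False using U by (simp add: invariant_flags_def)
    qed
    moreover have "(LEAST i. v \<in> U i) \<le> d" using d by (rule Least_le)
    moreover have "v \<in> U i \<longleftrightarrow> (LEAST i. v \<in> U i) \<le> i" if "i \<le> d" for i
      using L mono that by (blast intro: Least_le)
    ultimately show ?thesis by simp
  qed
  show "\<forall>U\<in>invariant_flags d V T. flag_of d V (\<lambda>v\<in>V. LEAST i. v \<in> U i) = U"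
  proof (intro ballI ext)
    fix U i assume U: "U \<in> invariant_flags d V T"
    then have E: "U \<in> {0..d} \<rightarrow>\<^sub>E Pow V" by (simp add: invariant_flags_def)
    show "flag_of d V (\<lambda>v\<in>V. LEAST i. v \<in> U i) i = U i"
    proof (cases "i \<le> d")
      case True
      then have "U i \<subseteq> V" using PiE_mem[OF E, of i] by auto
      then show ?thesis using least[OF U] True by (auto simp: flag_of_def)
    next
      case False
      then show ?thesis using E by (auto simp: flag_of_def PiE_def extensional_def)
    qed
  qed
  show "(\<lambda>U. \<lambda>v\<in>V. LEAST i. v \<in> U i) ` invariant_flags d V T \<subseteq> labellings d V T"
  proof (intro image_subsetI)
    fix U assume U: "U \<in> invariant_flags d V T"
    have "(LEAST i. T v \<in> U i) \<le> (LEAST i. v \<in> U i)" if v: "v \<in> V" for v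
    proof -
      let ?i = "LEAST i. v \<in> U i"
      have i: "?i \<le> d" and "v \<in> U ?i" using least[OF U v] by auto
      moreover from i have "T ` U ?i \<subseteq> U ?i"
        using U unfolding invariant_flags_def invariant_subset_def by blast
      ultimately have "T v \<in> U ?i" by blast
      then show ?thesis by (rule Least_le)
    qed
    then show "(\<lambda>v\<in>V. LEAST i. v \<in> U i) \<in> labellings d V T"
      using least[OF U] by (auto simp: labellings_def)
  qed
  show "flag_of d V ` labellings d V T \<subseteq> invariant_flags d V T"
  proof (intro image_subsetI)
    fix f assume f: "f \<in> labellings d V T"
    then have range: "1 \<le> f v" "f v \<le> d" if "v \<in> V" for v
      using that by (auto simp: labellings_def PiE_iff)
    have mono: "f (T v) \<le> f v" if "v \<in> V" for v
      using that f assms(1) by (auto simp: labellings_def)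
    have "flag_of d V f 0 = {}" "flag_of d V f d = V"
      using range by (force simp: flag_of_def)+
    moreover have "invariant_subset T (flag_of d V f i)" if "i \<le> d" for i
      using mono assms(1) that by (auto simp: flag_of_def invariant_subset_def intro: order_trans)
    moreover have "flag_of d V f i \<subseteq> flag_of d V f (Suc i)" if "i < d" for i
      using that by (auto simp: flag_of_def)
    moreover have "flag_of d V f \<in> {0..d} \<rightarrow>\<^sub>E Pow V"
      by (auto simp: flag_of_def)
    ultimately show "flag_of d V f \<in> invariant_flags d V T"
      by (auto simp: invariant_flags_def)
  qed
qed

lemma card_flag_of:
  assumes "finite V" "f \<in> labellings d V T" "i \<le> d"
  shows "card (flag_of d V f i) = (\<Sum>k=1..i. label_counts d V f k)"
proof -
  have "flag_of d V f i = (\<Union>k\<in>{1..i}. {v \<in> V. f v = k})"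
    using assms(2,3) by (auto simp: flag_of_def labellings_def PiE_iff)
  also have "card \<dots> = (\<Sum>k=1..i. card {v \<in> V. f v = k})"
    using assms(1) by (intro card_UN_disjoint) auto
  also have "\<dots> = (\<Sum>k=1..i. label_counts d V f k)"
    using assms(3) by (intro sum.cong) (auto simp: label_counts_def)
  finally show ?thesis .
qed

text \<open>Flags prescribe the partial sums of J, labellings its single entries; cancelling
  successive sums passes between the two.\<close>

lemma partial_sums_eq_iff:
  fixes F G :: "nat \<Rightarrow> 'a::cancel_comm_monoid_add"
  shows "(\<forall>i\<in>{1..d}. (\<Sum>k=1..i. F k) = (\<Sum>k=1..i. G k)) \<longleftrightarrow> (\<forall>i\<in>{1..d}. F i = G i)"
proof
  assume eq: "\<forall>i\<in>{1..d}. (\<Sum>k=1..i. F k) = (\<Sum>k=1..i. G k)"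
  show "\<forall>i\<in>{1..d}. F i = G i"
  proof
    fix i assume i: "i \<in> {1..d}"
    then obtain m where m: "i = Suc m" by (cases i) auto
    have "(\<Sum>k=1..m. F k) = (\<Sum>k=1..m. G k)"
      using eq i m by (cases "m = 0") auto
    moreover have "(\<Sum>k=1..m. F k) + F i = (\<Sum>k=1..m. G k) + G i"
      using eq i m by (auto dest!: bspec[where x = i])
    ultimately show "F i = G i" by simp
  qed
next
  assume eq: "\<forall>i\<in>{1..d}. F i = G i"
  show "\<forall>i\<in>{1..d}. (\<Sum>k=1..i. F k) = (\<Sum>k=1..i. G k)"
    using eq by (auto intro!: sum.cong)
qed

lemma flag_count_eq_card_labellings:
  assumes "finite V" "T ` V \<subseteq> V" "d > 0" "J \<in> {1..d} \<rightarrow>\<^sub>E UNIV"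
  shows "flag_count d V T J = card {f \<in> labellings d V T. label_counts d V f = J}"
proof -
  have iff: "(\<forall>i\<in>{1..d}. card (flag_of d V f i) = (\<Sum>k=1..i. J k)) \<longleftrightarrow> label_counts d V f = J"
    if f: "f \<in> labellings d V T" for f
  proof -
    have "(\<forall>i\<in>{1..d}. card (flag_of d V f i) = (\<Sum>k=1..i. J k)) \<longleftrightarrow>
        (\<forall>i\<in>{1..d}. (\<Sum>k=1..i. label_counts d V f k) = (\<Sum>k=1..i. J k))"
      using card_flag_of[OF assms(1) f] by simp
    also have "\<dots> \<longleftrightarrow> (\<forall>i\<in>{1..d}. label_counts d V f i = J i)"
      by (rule partial_sums_eq_iff)
    also have "\<dots> \<longleftrightarrow> label_counts d V f = J"
      using assms(4) extensionalityI[of "label_counts d V f" "{1..d}" J]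
      by (auto simp: PiE_def label_counts_def)
    finally show ?thesis .
  qed
  have B: "bij_betw (flag_of d V) (labellings d V T) (invariant_flags d V T)"
    using assms by (intro bij_betw_flag_of)
  have "flag_of d V ` {f \<in> labellings d V T. label_counts d V f = J} =
      {U \<in> invariant_flags d V T. \<forall>i\<in>{1..d}. card (U i) = (\<Sum>k=1..i. J k)}"
    unfolding bij_betw_imp_surj_on[OF B, symmetric] using iff by blast
  moreover have "inj_on (flag_of d V) {f \<in> labellings d V T. label_counts d V f = J}"
    using bij_betw_imp_inj_on[OF B] by (rule inj_on_subset) auto
  ultimately have "bij_betw (flag_of d V) {f \<in> labellings d V T. label_counts d V f = J}
      {U \<in> invariant_flags d V T. \<forall>i\<in>{1..d}. card (U i) = (\<Sum>k=1..i. J k)}"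
    by (simp add: bij_betw_def)
  then show ?thesis by (simp add: flag_count_def bij_betw_same_card)
qed

text \<open>Group the labellings by their label counts J: each labelling in the class of J has the
  monomial of J as its weight.\<close>

lemma flag_gf_eq_sum_labellings:
  fixes t :: "nat \<Rightarrow> 'b::comm_semiring_1"
  assumes "finite V" "T ` V \<subseteq> V" "d > 0"
  shows "flag_gf d V T t = (\<Sum>f\<in>labellings d V T. \<Prod>v\<in>V. t (f v))"
proof -
  let ?L = "labellings d V T" and ?c = "label_counts d V"
  let ?J = "{J \<in> {1..d} \<rightarrow>\<^sub>E UNIV. flag_count d V T J \<noteq> 0}"
  have wt: "(\<Prod>v\<in>V. t (f v)) = (\<Prod>i=1..d. t i ^ ?c f i)" if "f \<in> ?L" for f
  proof -
    have "(\<Prod>v\<in>V. t (f v)) = (\<Prod>i=1..d. \<Prod>v\<in>{v \<in> V. f v = i}. t (f v))"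
      using assms(1) that by (intro prod.group[symmetric]) (auto simp: labellings_def)
    also have "\<dots> = (\<Prod>i=1..d. t i ^ ?c f i)"
      by (intro prod.cong) (auto simp: label_counts_def)
    finally show ?thesis .
  qed
  have fin: "finite ?L" using assms(1) by (rule finite_labellings)
  \<comment> \<open>No class is lost by summing over nonzero coefficients only, as a labelling is
    itself counted by the coefficient of its own label counts.\<close>
  have J: "?c ` ?L \<subseteq> ?J"
  proof (intro image_subsetI)
    fix f assume f: "f \<in> ?L"
    have E: "?c f \<in> {1..d} \<rightarrow>\<^sub>E UNIV" by (simp add: label_counts_def)
    have "card {g \<in> ?L. ?c g = ?c f} \<noteq> 0" using fin f by auto
    then show "?c f \<in> ?J"
      using flag_count_eq_card_labellings[OF assms E] E by simp
  qed
  have "flag_gf d V T t = (\<Sum>J\<in>?J. \<Sum>f\<in>{f \<in> ?L. ?c f = J}. \<Prod>v\<in>V. t (f v))"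
    unfolding flag_gf_def
  proof (intro sum.cong refl)
    fix J assume "J \<in> ?J"
    then have "flag_count d V T J = card {f \<in> ?L. ?c f = J}"
      using flag_count_eq_card_labellings[OF assms] by simp
    moreover have "(\<Sum>f\<in>{f \<in> ?L. ?c f = J}. \<Prod>v\<in>V. t (f v)) =
        (\<Sum>f\<in>{f \<in> ?L. ?c f = J}. \<Prod>i=1..d. t i ^ J i)"
      by (intro sum.cong) (auto simp: wt)
    ultimately show "of_nat (flag_count d V T J) * (\<Prod>i=1..d. t i ^ J i) =
        (\<Sum>f\<in>{f \<in> ?L. ?c f = J}. \<Prod>v\<in>V. t (f v))"
      by simp
  qed
  also have "\<dots> = (\<Sum>f\<in>?L. \<Prod>v\<in>V. t (f v))"
    using fin finite_flag_gf_support[OF assms(1)] J by (rule sum.group)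
  finally show ?thesis .
qed

section \<open>Removing a path of vertices\<close>

text \<open>Since no vertex of \<open>S\<close> maps to \<open>x\<close>, the label i of
  \<open>x\<close> is bounded only from below, by the label of \<open>T x\<close> or by 1. Summing
  z^i * h_r(z^i, ..., z^d) over these i gives h_(r+1) starting at that bound.\<close>

lemma sum_labellings_insert:
  fixes z :: "'b::comm_semiring_1"
  assumes "finite S" "x \<notin> S" "x \<notin> T ` S"
  shows "(\<Sum>f\<in>labellings d (insert x S) T. (\<Prod>v\<in>insert x S. z ^ f v) * hom_sum d z r (f x)) =
    (\<Sum>f\<in>labellings d S T.
       (\<Prod>v\<in>S. z ^ f v) * hom_sum d z (Suc r) (if T x \<in> S then f (T x) else 1))"
proof -
  let ?b = "\<lambda>f. if T x \<in> S then f (T x) else (1::nat)"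
  have ext: "f(x := i) \<in> labellings d (insert x S) T \<longleftrightarrow> i \<in> {?b f..d}"
    if f: "f \<in> labellings d S T" for f i
  proof -
    have fin: "\<And>v. v \<in> S \<Longrightarrow> f v \<in> {1..d}" and E: "f \<in> S \<rightarrow>\<^sub>E {1..d}"
      using f by (auto simp: labellings_def)
    have b: "1 \<le> ?b f" using fin by auto
    have mem: "f(x := i) \<in> insert x S \<rightarrow>\<^sub>E {1..d} \<longleftrightarrow> i \<in> {1..d}"
      using E assms(2) by (auto simp: PiE_iff extensional_def)
    \<comment> \<open>This covers \<open>T x = x\<close>, as at the root: the loop imposes nothing,
      and the bound is then 1.\<close>
    have mono: "(\<forall>v\<in>insert x S. T v \<in> insert x S \<longrightarrow> (f(x := i)) (T v) \<le> (f(x := i)) v)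
        \<longleftrightarrow> (T x \<in> S \<longrightarrow> f (T x) \<le> i)"
      using f assms(2,3) by (auto simp: labellings_def)
    show ?thesis
      unfolding labellings_def mem_Collect_eq mem mono using b by auto
  qed
  have rest: "restrict f S \<in> labellings d S T" if "f \<in> labellings d (insert x S) T" for f
    using that by (auto simp: labellings_def PiE_iff)
  have "(\<Sum>f\<in>labellings d (insert x S) T. (\<Prod>v\<in>insert x S. z ^ f v) * hom_sum d z r (f x)) =
      (\<Sum>(f, i)\<in>(SIGMA f : labellings d S T. {?b f..d}).
         (\<Prod>v\<in>S. z ^ f v) * (z ^ i * hom_sum d z r i))"
  proof (rule sum.reindex_bij_witness[where i = "\<lambda>(f, i). f(x := i)" and j = "\<lambda>f. (restrict f S, f x)"])
    fix f assume f: "f \<in> labellings d (insert x S) T"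
    have "f \<in> extensional (insert x S)" using f by (auto simp: labellings_def PiE_def)
    then have upd: "(restrict f S)(x := f x) = f" by (auto simp: extensional_def fun_eq_iff)
    then show "(case (restrict f S, f x) of (f, i) \<Rightarrow> f(x := i)) = f" by simp
    show "(restrict f S, f x) \<in> (SIGMA f : labellings d S T. {?b f..d})"
      using ext[OF rest[OF f], of "f x"] upd f rest[OF f] by simp
    have "(\<Prod>v\<in>S. z ^ restrict f S v) = (\<Prod>v\<in>S. z ^ f v)"
      by (intro prod.cong) auto
    then show "(case (restrict f S, f x) of (f, i) \<Rightarrow> (\<Prod>v\<in>S. z ^ f v) * (z ^ i * hom_sum d z r i)) =
        (\<Prod>v\<in>insert x S. z ^ f v) * hom_sum d z r (f x)"
      using assms(1,2) by (simp add: mult_ac)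
  next
    fix p assume p: "p \<in> (SIGMA f : labellings d S T. {?b f..d})"
    then obtain f i where p': "p = (f, i)" "f \<in> labellings d S T" "i \<in> {?b f..d}" by auto
    show "(case p of (f, i) \<Rightarrow> f(x := i)) \<in> labellings d (insert x S) T"
      using ext[OF p'(2)] p' by simp
    have "f \<in> extensional S" using p' by (auto simp: labellings_def PiE_def)
    then show "(restrict (case p of (f, i) \<Rightarrow> f(x := i)) S, (case p of (f, i) \<Rightarrow> f(x := i)) x) = p"
      using p'(1) assms(2) by (auto simp: extensional_def fun_eq_iff)
  qed
  also have "\<dots> = (\<Sum>f\<in>labellings d S T. \<Sum>i=?b f..d. (\<Prod>v\<in>S. z ^ f v) * (z ^ i * hom_sum d z r i))"
    using finite_labellings[OF assms(1)] by (intro sum.Sigma[symmetric]) auto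
  also have "\<dots> = (\<Sum>f\<in>labellings d S T. (\<Prod>v\<in>S. z ^ f v) * hom_sum d z (Suc r) (?b f))"
    by (simp add: sum_distrib_left)
  finally show ?thesis .
qed

text \<open>The path is removed from its start w upwards. Removing a vertex leaves a factor
  \<open>hom_sum\<close> that depends on the label of its image, the next vertex of the path, so the
  next removal raises the degree by one. After d removals the factor is 1.\<close>

lemma sum_labellings_add_path:
  fixes z :: "'b::idom"
  assumes "finite S" "primitive_root_of_unity d z" "d > 0"
    and inj: "inj_on (\<lambda>i. (T ^^ i) w) {..<d}"
    and disj: "\<And>i. i < d \<Longrightarrow> (T ^^ i) w \<notin> S"
    and leaf: "\<And>i. i < d \<Longrightarrow> (T ^^ i) w \<notin> T ` (S \<union> (\<lambda>i. (T ^^ i) w) ` {Suc i..<d})"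
  shows "(\<Sum>f\<in>labellings d (S \<union> (\<lambda>i. (T ^^ i) w) ` {..<d}) T.
            \<Prod>v\<in>S \<union> (\<lambda>i. (T ^^ i) w) ` {..<d}. z ^ f v) =
         (\<Sum>f\<in>labellings d S T. \<Prod>v\<in>S. z ^ f v)"
proof -
  let ?x = "\<lambda>i. (T ^^ i) w"
  define P where "P k = S \<union> ?x ` {k..<d}" for k
  \<comment> \<open>\<open>P k\<close> is what remains after k removals, and \<open>b k f\<close> is
    the least label allowed at the k-th path vertex. Its default 1 can occur only at the end of the
    path, when the image lies outside \<open>S\<close>.\<close>
  define b where "b k f = (if T (?x k) \<in> P (Suc k) then f (T (?x k)) else 1)" for k and f :: "_ \<Rightarrow> nat"
  have ins: "P k = insert (?x k) (P (Suc k))" "?x k \<notin> P (Suc k)" if "k < d" for k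
  proof -
    have "{k..<d} = insert k {Suc k..<d}" using that by auto
    then show "P k = insert (?x k) (P (Suc k))" by (auto simp: P_def)
    have "?x k \<notin> ?x ` {Suc k..<d}"
      using inj_onD[OF inj, of k] that by fastforce
    then show "?x k \<notin> P (Suc k)" using disj[OF that] by (auto simp: P_def)
  qed
  have step: "(\<Sum>f\<in>labellings d (P k) T. (\<Prod>v\<in>P k. z ^ f v) * hom_sum d z k (f (?x k))) =
      (\<Sum>f\<in>labellings d (P (Suc k)) T. (\<Prod>v\<in>P (Suc k). z ^ f v) * hom_sum d z (Suc k) (b k f))"
    if "k < d" for k
    unfolding ins(1)[OF that] b_def
    using assms(1) ins(2)[OF that] leaf[OF that]
    by (intro sum_labellings_insert) (auto simp: P_def)
  have main: "(\<Sum>f\<in>labellings d (P 0) T. \<Prod>v\<in>P 0. z ^ f v) =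
      (\<Sum>f\<in>labellings d (P (Suc k)) T. (\<Prod>v\<in>P (Suc k). z ^ f v) * hom_sum d z (Suc k) (b k f))"
    if "k < d" for k
    using that
  proof (induction k)
    case 0
    then show ?case using step[of 0] by simp
  next
    case (Suc k)
    have "b k f = f (?x (Suc k))" for f
    proof -
      have "T (?x k) \<in> P (Suc k)" using ins(1)[OF Suc.prems] by simp
      then show ?thesis by (simp add: b_def)
    qed
    then show ?case using Suc step[of "Suc k"] by simp
  qed
  obtain k where k: "d = Suc k" using assms(3) by (cases d) auto
  have Pd: "P d = S" "P 0 = S \<union> ?x ` {..<d}" by (auto simp: P_def atLeast0LessThan)
  have "hom_sum d z d (b k f) = 1" if "f \<in> labellings d S T" for f
  proof -
    \<comment> \<open>Both a label and the default 1 lie in the range where h_d equals 1.\<close>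
    have "b k f \<in> {1..d}" using that k assms(3) Pd(1) by (auto simp: b_def labellings_def)
    then show ?thesis using hom_sum_primitive_root[OF assms(2)] by simp
  qed
  then have "(\<Sum>f\<in>labellings d (P (Suc k)) T. (\<Prod>v\<in>P (Suc k). z ^ f v) * hom_sum d z (Suc k) (b k f)) =
      (\<Sum>f\<in>labellings d S T. \<Prod>v\<in>S. z ^ f v)"
    using Pd(1) k by (intro sum.cong) auto
  then show ?thesis using main[of k] k Pd(2) by simp
qed

section \<open>Splitting subsets of a rooted tree\<close>

text \<open>The form in which the tree enters the counting argument: arcs are replaced by iterates
  of \<open>T\<close> ending at the fixed point \<open>R\<close>.\<close>

locale rooted_map =
  fixes V :: "'a set" and T :: "'a \<Rightarrow> 'a" and R :: 'a
  assumes finite_V: "finite V" and T_closed: "T ` V \<subseteq> V" and T_root: "T R = R"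
    and reaches_root: "v \<in> V \<Longrightarrow> \<exists>k. (T ^^ k) v = R"
begin

section \<open>Distance to the root\<close>

definition depth :: "'a \<Rightarrow> nat" where
  "depth v = (LEAST k. (T ^^ k) v = R)"

lemma funpow_depth: "v \<in> V \<Longrightarrow> (T ^^ depth v) v = R"
  unfolding depth_def using reaches_root by (rule LeastI_ex)

lemma depth_eq_0_iff: "v \<in> V \<Longrightarrow> depth v = 0 \<longleftrightarrow> v = R"
proof
  assume "v \<in> V" "depth v = 0"
  then show "v = R" using funpow_depth[of v] by simp
next
  assume "v = R"
  then have "depth v \<le> 0" unfolding depth_def by (intro Least_le) simp
  then show "depth v = 0" by simp
qed

text \<open>Truncated subtraction covers the root, where both depths are 0.\<close>

lemma depth_T:
  assumes "v \<in> V"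
  shows "depth (T v) = depth v - 1"
proof (cases "v = R")
  case True
  then show ?thesis using depth_eq_0_iff[OF assms] T_root by simp
next
  case False
  then obtain k where k: "depth v = Suc k"
    using depth_eq_0_iff[OF assms] by (cases "depth v") auto
  have "T v \<in> V" using assms T_closed by auto
  have "(T ^^ k) (T v) = R" using funpow_depth[OF assms] k by (simp add: funpow_swap1)
  then have "depth (T v) \<le> k" unfolding depth_def by (rule Least_le)
  moreover have "(T ^^ Suc (depth (T v))) v = R"
    using funpow_depth[OF \<open>T v \<in> V\<close>] by (simp add: funpow_swap1)
  then have "depth v \<le> Suc (depth (T v))" unfolding depth_def[of v] by (rule Least_le)
  ultimately show ?thesis using k by simp
qed

lemma funpow_closed: "v \<in> V \<Longrightarrow> (T ^^ k) v \<in> V"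
  using T_closed by (induction k) auto

lemma depth_funpow: "v \<in> V \<Longrightarrow> depth ((T ^^ k) v) = depth v - k"
  by (induction k) (auto simp: depth_T funpow_closed)

section \<open>Uniqueness of the splitting subset\<close>

text \<open>The pairs (w, i) number (n / d) * d = n and map onto the n vertices, so each vertex has
  exactly one start and one position.\<close>

lemma splitting_subset_inj:
  assumes "splitting_subset d V T W" "d dvd card V"
  shows "inj_on (\<lambda>(w, i). (T ^^ i) w) (W \<times> {..<d})"
proof (rule eq_card_imp_inj_on)
  have W: "W \<subseteq> V" "card W = card V div d" "(\<Union>i<d. (T ^^ i) ` W) = V"
    using assms(1) by (auto simp: splitting_subset_def)
  then show "finite (W \<times> {..<d})" using finite_V by (auto intro: finite_subset)
  have "(\<lambda>(w, i). (T ^^ i) w) ` (W \<times> {..<d}) = V" unfolding W(3)[symmetric] by auto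
  then show "card ((\<lambda>(w, i). (T ^^ i) w) ` (W \<times> {..<d})) = card (W \<times> {..<d})"
    using W(2) assms(2) by (simp add: card_cartesian_product)
qed

lemma splitting_subset_injD:
  assumes "splitting_subset d V T W" "d dvd card V"
    and "(T ^^ i) w = (T ^^ j) w'" "w \<in> W" "w' \<in> W" "i < d" "j < d"
  shows "w = w'" "i = j"
  using inj_onD[OF splitting_subset_inj[OF assms(1,2)], of "(w, i)" "(w', j)"] assms(3-) by auto

text \<open>The position \<open>i\<close> of a vertex \<open>T\<^sup>i w\<close> on its path is determined by the positions of its
  preimages, hence by induction from the leaves towards the root.\<close>

lemma splitting_subset_position:
  assumes W: "splitting_subset d V T W" and W': "splitting_subset d V T W'"
    and dvd: "d dvd card V" and "v \<in> V" "i < d" "v \<in> (T ^^ i) ` W"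
  shows "v \<in> (T ^^ i) ` W'"
  using assms(4-)
\<comment> \<open>Preimages other than the vertex itself are deeper, so the deepest vertices come
  first.\<close>
proof (induction "Max (depth ` V) - depth v" arbitrary: v i rule: less_induct)
  case less
  have sub: "W \<subseteq> V" "W' \<subseteq> V" using W W' by (auto simp: splitting_subset_def)
  have cov: "\<exists>j<d. u \<in> (T ^^ j) ` X" if "u \<in> V" "splitting_subset d V T X" for u X
    using that by (auto simp: splitting_subset_def)
  have smaller: "Max (depth ` V) - depth c < Max (depth ` V) - depth v"
    if "c \<in> V" "T c = v" "c \<noteq> v" for c
  proof -
    have "depth c \<noteq> 0" using that T_root depth_eq_0_iff[of c] by auto
    moreover have "depth c \<le> Max (depth ` V)" using that(1) finite_V by simp
    moreover have "depth v = depth c - 1" using depth_T that by auto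
    ultimately show ?thesis by linarith
  qed
  \<comment> \<open>By injectivity the predecessor on a path differs from v. This excludes the loop
    at the root, along which the depth does not grow.\<close>
  have child: "\<exists>c\<in>(T ^^ k) ` X. c \<in> V \<and> T c = v \<and> c \<noteq> v"
    if X: "splitting_subset d V T X" and v: "v \<in> (T ^^ Suc k) ` X" and k: "Suc k < d" for X k
  proof -
    obtain w where w: "w \<in> X" "v = (T ^^ Suc k) w" using v by auto
    have "(T ^^ k) w \<noteq> v"
      using splitting_subset_injD(2)[OF X dvd, of k w "Suc k" w] w k by auto
    moreover have "(T ^^ k) w \<in> V"
      using w(1) X funpow_closed unfolding splitting_subset_def by blast
    ultimately show ?thesis using w by auto
  qed
  have up: "T c \<in> (T ^^ Suc k) ` X" if "c \<in> (T ^^ k) ` X" for c k and X :: "'a set"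
    using that by auto
  show ?case
  proof (cases i)
    case (Suc k)
    then obtain c where "c \<in> (T ^^ k) ` W" "c \<in> V" "T c = v" "c \<noteq> v"
      using child[OF W, of k] less.prems by auto
    then show ?thesis using less.hyps[of c k] smaller[of c] up[of c k W'] less.prems Suc by auto
  next
    case 0
    \<comment> \<open>If v starts a path of \<open>W\<close> but has position m + 1 for
      \<open>W'\<close>, its predecessor c for \<open>W'\<close> has the same position m for both by
      induction. Then v = T c also has position m + 1 for \<open>W\<close>, contradicting position
      0.\<close>
    obtain j where j: "j < d" "v \<in> (T ^^ j) ` W'" using cov[OF less.prems(1) W'] by auto
    show ?thesis
    proof (cases j)
      case 0
      then show ?thesis using j \<open>i = 0\<close> by simp
    next
      case (Suc m)
      then obtain c where c: "c \<in> (T ^^ m) ` W'" "c \<in> V" "T c = v" "c \<noteq> v"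
        using child[OF W', of m] j by auto
      obtain k where k: "k < d" "c \<in> (T ^^ k) ` W" using cov[OF c(2) W] by auto
      have "c \<in> (T ^^ k) ` W'" using less.hyps[of c k] smaller[of c] c k by auto
      then have "k = m"
        using splitting_subset_injD(2)[OF W' dvd, of k _ m] c(1) k(1) j(1) Suc by auto
      then have "v \<in> (T ^^ j) ` W" using up[OF k(2)] c(3) Suc by simp
      then have "j = 0"
        using splitting_subset_injD(2)[OF W dvd, of j _ 0] less.prems \<open>i = 0\<close> j(1) by auto
      then show ?thesis using Suc by simp
    qed
  qed
qed

lemma splitting_subset_unique:
  assumes "splitting_subset d V T W" "splitting_subset d V T W'" "d dvd card V" "d > 0"
  shows "W = W'"
proof -
  have "X \<subseteq> Y" if X: "splitting_subset d V T X" and Y: "splitting_subset d V T Y" for X Y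
  proof
    fix v assume v: "v \<in> X"
    then have "v \<in> V" using X by (auto simp: splitting_subset_def)
    then show "v \<in> Y"
      using splitting_subset_position[OF X Y assms(3), of v 0] v assms(4) by simp
  qed
  then show ?thesis using assms(1,2) by blast
qed

section \<open>Assembling the tree from its paths\<close>

lemma sum_labellings_splitting:
  fixes z :: "'b::idom"
  assumes W: "splitting_subset d V T W" and dvd: "d dvd card V" and "d > 0"
    and z: "primitive_root_of_unity d z"
  shows "(\<Sum>f\<in>labellings d V T. \<Prod>v\<in>V. z ^ f v) = 1"
proof -
  let ?U = "\<lambda>X. \<Union>i<d. (T ^^ i) ` X"
  have sub: "W \<subseteq> V" and cover: "?U W = V" using W by (auto simp: splitting_subset_def)
  note inj = splitting_subset_injD[OF W dvd]
  \<comment> \<open>A path reaching \<open>R\<close> before its last vertex would stay there and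
    repeat \<open>R\<close>, against injectivity.\<close>
  have depth_ge: "i \<le> depth w" if "w \<in> W" "i < d" for w i
  proof (rule ccontr)
    assume "\<not> i \<le> depth w"
    moreover have w: "w \<in> V" using that sub by auto
    ultimately have "(T ^^ depth w) w = (T ^^ i) w"
      using depth_eq_0_iff[of "(T ^^ i) w"] depth_funpow[of w i] funpow_closed[of w i] funpow_depth[of w]
      by simp
    then show False using inj(2)[of "depth w" w i w] that \<open>\<not> i \<le> depth w\<close> by simp
  qed
  \<comment> \<open>Adding the paths by increasing depth of their start, no vertex of the path being added
    has a preimage on an earlier path.\<close>
  have "X \<subseteq> W \<Longrightarrow> (\<Sum>f\<in>labellings d (?U X) T. \<Prod>v\<in>?U X. z ^ f v) = 1" if "finite X" for X
    using that
  proof (induction X rule: finite_ranking_induct[where f = depth])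
    case empty
    then show ?case by (simp add: labellings_def)
  next
    case (insert w X)
    show ?case
    proof (cases "w \<in> X")
      case True
      then show ?thesis using insert by (simp add: insert_absorb)
    next
      case False
      have w: "w \<in> W" "w \<in> V" and X: "X \<subseteq> W" using insert.prems sub by auto
      have disj: "(T ^^ i) w \<notin> ?U X" if "i < d" for i
        using inj(1)[of i w] w X False that by auto
      have leaf: "(T ^^ i) w \<notin> T ` (?U X \<union> (\<lambda>i. (T ^^ i) w) ` {Suc i..<d})" if i: "i < d" for i
      proof
        assume "(T ^^ i) w \<in> T ` (?U X \<union> (\<lambda>i. (T ^^ i) w) ` {Suc i..<d})"
        then consider j where "Suc i \<le> j" "j < d" "(T ^^ i) w = (T ^^ Suc j) w"
          | j u where "j < d" "u \<in> X" "(T ^^ i) w = (T ^^ Suc j) u"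
          by auto
        then show False
        proof cases
          case 1
          \<comment> \<open>As i < j <= depth w, the left side is strictly larger, even if the right
            side is truncated to 0.\<close>
          then have "depth w - i = depth w - Suc j" using depth_funpow[OF w(2)] by metis
          then show ?thesis using 1 depth_ge[OF w(1), of j] by simp
        next
          case 2
          \<comment> \<open>Distinct paths are disjoint, so the image of the j-th vertex of the path
            of u has left that path: j = d - 1. That vertex is not \<open>R\<close>, so depth u >=
            d. With i < d, comparing depths gives depth w < depth u, against the order of
            insertion.\<close>
          have u: "u \<in> W" "u \<in> V" "u \<noteq> w" using 2 X sub False by auto
          have "Suc j = d" using inj(1)[of i w "Suc j" u] 2 w u i by fastforce
          have "depth w - i = depth u - d" using depth_funpow w(2) u(2) 2(3) \<open>Suc j = d\<close> by metis
          moreover have "depth u \<noteq> j"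
          proof
            assume "depth u = j"
            then have "(T ^^ i) w = (T ^^ j) u" using 2(3) funpow_depth[OF u(2)] T_root by simp
            then show False using inj(1)[of i w j u] 2(1) w u i by simp
          qed
          moreover have "j \<le> depth u" using depth_ge[OF u(1) 2(1)] .
          moreover have "i \<le> depth w" using depth_ge[OF w(1) i] .
          moreover have "depth u \<le> depth w" using insert.hyps 2(2) by blast
          ultimately show ?thesis using \<open>Suc j = d\<close> i by linarith
        qed
      qed
      have fin: "finite (?U X)" using insert.hyps by simp
      have injw: "inj_on (\<lambda>i. (T ^^ i) w) {..<d}" using inj(2) w(1) by (auto intro!: inj_onI)
      have "?U (insert w X) = ?U X \<union> (\<lambda>i. (T ^^ i) w) ` {..<d}" by auto
      then show ?thesis
        using sum_labellings_add_path[OF fin z assms(3) injw disj leaf] insert.IH X by simp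
    qed
  qed
  then show ?thesis using sub finite_V cover by (metis finite_subset order_refl)
qed

end

section \<open>From arcs to iterates of the map\<close>

text \<open>An orbit of \<open>T\<close> avoiding \<open>R\<close> follows arcs forever in a finite
  set, so it closes up. A shortest closed stretch is a loop, a pair of opposite arcs or an
  undirected cycle, all excluded in a directed tree.\<close>

lemma rooted_map_of_rooted_tree:
  assumes "rooted_tree_endofunction V A R T"
  shows "rooted_map V T R"
proof
  have tree: "directed_tree V A" and "R \<in> V" and root: "T R = R"
    and arc: "\<And>v. v \<in> V \<Longrightarrow> v \<noteq> R \<Longrightarrow> (v, T v) \<in> A"
    using assms by (auto simp: rooted_tree_endofunction_def rooted_tree_def)
  have fin: "finite V" and AV: "A \<subseteq> V \<times> V" and asym: "\<And>u v. (u, v) \<in> A \<Longrightarrow> (v, u) \<notin> A"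
    and nocycle: "\<And>xs. \<not> undirected_cycle A xs"
    using tree by (auto simp: directed_tree_def)
  show "finite V" "T R = R" by fact+
  have TV: "T v \<in> V" if "v \<in> V" for v
    using arc[OF that] AV root that by (cases "v = R") auto
  then show "T ` V \<subseteq> V" by auto
  fix v assume v: "v \<in> V"
  have powV: "(T ^^ k) v \<in> V" for k using v TV by (induction k) auto
  show "\<exists>k. (T ^^ k) v = R"
  proof (rule ccontr)
    assume never: "\<nexists>k. (T ^^ k) v = R"
    have arcs: "((T ^^ k) v, (T ^^ Suc k) v) \<in> A" for k
      using arc[OF powV[of k]] never by auto
    have "\<not> inj (\<lambda>k. (T ^^ k) v)"
    proof
      assume "inj (\<lambda>k. (T ^^ k) v)"
      moreover have "finite (range (\<lambda>k. (T ^^ k) v))"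
        using powV fin by (auto intro: finite_subset)
      ultimately show False using finite_imageD infinite_UNIV_nat by blast
    qed
    then obtain i j where "i < j" "(T ^^ i) v = (T ^^ j) v"
      by (metis (mono_tags, lifting) injI linorder_less_linear)
    then have "\<exists>L>0. \<exists>i. (T ^^ (i + L)) v = (T ^^ i) v"
      by (intro exI[of _ "j - i"]) (auto intro!: exI[of _ i])
    \<comment> \<open>\<open>L\<close> is minimal over all starting indices at once, so a repetition
      inside the stretch chosen next would give a smaller value.\<close>
    then obtain L where L: "L > 0" "\<exists>i. (T ^^ (i + L)) v = (T ^^ i) v"
      and min: "\<And>M. M < L \<Longrightarrow> \<not> (M > 0 \<and> (\<exists>i. (T ^^ (i + M)) v = (T ^^ i) v))"
      using exists_least_iff[of "\<lambda>L. L > 0 \<and> (\<exists>i. (T ^^ (i + L)) v = (T ^^ i) v)"] by blast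
    obtain i where i: "(T ^^ (i + L)) v = (T ^^ i) v" using L by auto
    let ?xs = "map (\<lambda>k. (T ^^ (i + k)) v) [0..<L]"
    have "L \<noteq> 1"
    proof
      assume "L = 1"
      then have "((T ^^ i) v, (T ^^ i) v) \<in> A" using i arcs[of i] by simp
      then show False using asym by blast
    qed
    moreover have "L \<noteq> 2"
    proof
      assume "L = 2"
      then have "((T ^^ Suc i) v, (T ^^ i) v) \<in> A" using i arcs[of "Suc i"] by simp
      then show False using asym arcs[of i] by blast
    qed
    ultimately have "3 \<le> L" using L(1) by linarith
    moreover have "distinct ?xs"
    proof -
      have "(T ^^ (i + a)) v \<noteq> (T ^^ (i + b)) v" if "a < b" "b < L" for a b
      proof
        assume "(T ^^ (i + a)) v = (T ^^ (i + b)) v"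
        then have "(T ^^ (i + a + (b - a))) v = (T ^^ (i + a)) v" using that by simp
        moreover have "b - a < L" "b - a > 0" using that by auto
        ultimately show False using min by blast
      qed
      then have "inj_on (\<lambda>k. (T ^^ (i + k)) v) {0..<L}"
        by (intro linorder_inj_onI) auto
      then show ?thesis by (simp add: distinct_map)
    qed
    moreover have "(?xs ! k, ?xs ! (Suc k mod length ?xs)) \<in> A \<union> A\<inverse>" if "k < length ?xs" for k
    proof (cases "Suc k = L")
      case True
      \<comment> \<open>The last vertex maps back to the first, which is the arc closing the
        cycle.\<close>
      then have "(T ^^ Suc (i + k)) v = (T ^^ i) v" using i by (metis add_Suc_right)
      then show ?thesis using True arcs[of "i + k"] L(1) by simp
    next
      case False
      then show ?thesis using that arcs[of "i + k"] by simp
    qed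
    ultimately have "undirected_cycle A ?xs" by (simp add: undirected_cycle_def)
    then show False using nocycle by blast
  qed
qed

theorem mainTheorem4:
  fixes d n :: nat and \<zeta> :: complex
    and A :: "(nat \<times> nat) set" and R :: nat and T :: "nat \<Rightarrow> nat"
  assumes "d > 0" and "n > 0" and "d dvd n"
    and "primitive_root_of_unity d \<zeta>"
    and "rooted_tree_endofunction {1..n} A R T"
    and "num_splitting_subsets d {1..n} T > 0"
  shows "of_nat (num_splitting_subsets d {1..n} T) = flag_gf d {1..n} T (\<lambda>i. \<zeta> ^ i)"
proof -
  interpret rooted_map "{1..n}" T R
    using assms(5) by (rule rooted_map_of_rooted_tree)
  have "{W. splitting_subset d {1..n} T W} \<noteq> {}"
    using assms(6) unfolding num_splitting_subsets_def by (intro notI) (simp only: card.empty)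
  then obtain W where W: "splitting_subset d {1..n} T W" by blast
  have dvd: "d dvd card {1..n}" using assms(3) by simp
  have "{W. splitting_subset d {1..n} T W} = {W}"
    using W splitting_subset_unique[OF _ W dvd assms(1)] by blast
  then have "num_splitting_subsets d {1..n} T = 1"
    by (simp add: num_splitting_subsets_def)
  moreover have "flag_gf d {1..n} T (\<lambda>i. \<zeta> ^ i) = 1"
    using flag_gf_eq_sum_labellings[OF finite_V T_closed assms(1), of "\<lambda>i. \<zeta> ^ i"]
      sum_labellings_splitting[OF W dvd assms(1,4)] by simp
  ultimately show ?thesis by simp
qed

end
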